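(* Let $S$ be a semitopological monoid in which all left shifts are open maps or all right shifts are open maps, and let $\sim$ be a congruence on $S$. Then the quotient space $S/\sim$ is $T_2$ (Hausdorff) if and only if $\sim$ is a closed congruence, i.e. $\sim$ is a closed subset of $S\times S$.
   Context: A semitopological monoid is a monoid $S$ with a topology (no separation axiom assumed) such that for every $a\in S$ the left shift $l_a\colon x\mapsto ax$ and the right shift $r_a\colon x\mapsto xa$ are continuous maps $S\to S$. Left (right) shifts are open if $l_a(U)$ (resp. $r_a(U)$) is open in $S$ for every $a\in S$ and every open $U\subseteq S$. A congruence on $S$ is an equivalence relation $\sim$ such that $x\sim y$ and $a\sim b$ imply $xa\sim yb$. $S/\sim$ carries the quotient topology and $S\times S$ the product topology. *)

theory Defs
  imports "HOL-Analysis.Analysis" "HOL-Algebra.Group"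
begin

text \<open>No separation axiom on \<open>T\<close> and no joint continuity of the multiplication is assumed.\<close>

locale semitopological_monoid = monoid S for S (structure) +
  fixes T :: "'a topology"
  assumes topspace_carrier: "topspace T = carrier S"
    and left_shift_continuous: "a \<in> carrier S \<Longrightarrow> continuous_map T T (\<lambda>x. a \<otimes> x)"
    and right_shift_continuous: "a \<in> carrier S \<Longrightarrow> continuous_map T T (\<lambda>x. x \<otimes> a)"

definition open_left_shifts :: "('a, 'b) monoid_scheme \<Rightarrow> 'a topology \<Rightarrow> bool" where
  "open_left_shifts S T \<longleftrightarrow> (\<forall>a\<in>carrier S. open_map T T (\<lambda>x. a \<otimes>\<^bsub>S\<^esub> x))"

definition open_right_shifts :: "('a, 'b) monoid_scheme \<Rightarrow> 'a topology \<Rightarrow> bool" where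
  "open_right_shifts S T \<longleftrightarrow> (\<forall>a\<in>carrier S. open_map T T (\<lambda>x. x \<otimes>\<^bsub>S\<^esub> a))"

definition monoid_congruence :: "('a, 'b) monoid_scheme \<Rightarrow> ('a \<times> 'a) set \<Rightarrow> bool" where
  "monoid_congruence S r \<longleftrightarrow> equiv (carrier S) r \<and>
     (\<forall>x y a b. (x, y) \<in> r \<longrightarrow> (a, b) \<in> r \<longrightarrow> (x \<otimes>\<^bsub>S\<^esub> a, y \<otimes>\<^bsub>S\<^esub> b) \<in> r)"

text \<open>The points of the quotient space are the equivalence classes, that is, the elements of
  \<open>topspace T // r\<close>; the canonical projection is \<open>\<lambda>x. r `` {x}\<close>.\<close>

definition quotient_space :: "'a topology \<Rightarrow> ('a \<times> 'a) set \<Rightarrow> 'a set topology" where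
  "quotient_space T r = topology
     (\<lambda>V. V \<subseteq> topspace T // r \<and> openin T {x \<in> topspace T. r `` {x} \<in> V})"

lemma openin_quotient_space:
  "openin (quotient_space T r) V \<longleftrightarrow>
     V \<subseteq> topspace T // r \<and> openin T {x \<in> topspace T. r `` {x} \<in> V}"
proof -
  let ?L = "\<lambda>V. V \<subseteq> topspace T // r \<and> openin T {x \<in> topspace T. r `` {x} \<in> V}"
  have "?L (V \<inter> W)" if "?L V" "?L W" for V W
  proof -
    have "{x \<in> topspace T. r `` {x} \<in> V \<inter> W} =
        {x \<in> topspace T. r `` {x} \<in> V} \<inter> {x \<in> topspace T. r `` {x} \<in> W}"
      by blast
    with that show ?thesis by auto
  qed
  moreover have "?L (\<Union>K)" if "\<forall>V\<in>K. ?L V" for K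
  proof -
    have "{x \<in> topspace T. r `` {x} \<in> \<Union>K} = (\<Union>V\<in>K. {x \<in> topspace T. r `` {x} \<in> V})"
      by blast
    with that show ?thesis by auto
  qed
  ultimately have "istopology ?L"
    unfolding istopology_def by blast
  then show ?thesis
    unfolding quotient_space_def by (simp add: topology_inverse')
qed

lemma topspace_quotient_space: "topspace (quotient_space T r) = topspace T // r"
proof
  show "topspace (quotient_space T r) \<subseteq> topspace T // r"
    unfolding topspace_def[of "quotient_space T r"] openin_quotient_space by blast
  have "{x \<in> topspace T. r `` {x} \<in> topspace T // r} = topspace T"
    by (auto intro: quotientI)
  then have "openin (quotient_space T r) (topspace T // r)"
    by (simp add: openin_quotient_space)
  then show "topspace T // r \<subseteq> topspace (quotient_space T r)"
    by (rule openin_subset)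
qed

lemma quotient_map_quotient_space: "quotient_map T (quotient_space T r) (\<lambda>x. r `` {x})"
  unfolding quotient_map_def topspace_quotient_space openin_quotient_space
  by (auto simp: quotient_def)

end

theory Submission
  imports Defs
begin

text \<open>The open shifts make the canonical projection \<open>q\<close> an open map. Suppose the left shifts are
  open, and let \<open>x\<close> be a point of an open set \<open>U\<close> with \<open>x \<sim> y\<close>. Continuity of \<open>l\<^sub>x\<close> at the identity
  gives an open neighbourhood \<open>W\<close> of \<open>1\<close> with \<open>xW \<subseteq> U\<close>; then \<open>yW\<close> is an open neighbourhood of \<open>y\<close>,
  and \<open>yw \<sim> xw\<close> shows that \<open>yW\<close> lies in the saturation of \<open>U\<close>. Hence \<open>q \<times> q\<close> is open, thus a
  quotient map, and \<open>\<sim>\<close> is the preimage of the diagonal under it.\<close>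

text \<open>A point of the image lifts to a point of \<open>U\<close>, which lies in an open box
  inside \<open>U\<close>; the product map sends that box to a box with open sides.\<close>

lemma open_map_map_prod:
  assumes "open_map X X' f" and "open_map Y Y' g"
  shows "open_map (prod_topology X Y) (prod_topology X' Y') (map_prod f g)"
  unfolding open_map_def
proof (intro allI impI)
  fix U assume U: "openin (prod_topology X Y) U"
  show "openin (prod_topology X' Y') (map_prod f g ` U)"
    unfolding openin_prod_topology_alt
  proof (intro allI impI)
    fix x' y' assume "(x', y') \<in> map_prod f g ` U"
    then obtain x y where xy: "(x, y) \<in> U" "x' = f x" "y' = g y"
      by auto
    then obtain V W where "openin X V" "openin Y W" "x \<in> V" "y \<in> W" "V \<times> W \<subseteq> U"
      using U unfolding openin_prod_topology_alt by metis
    moreover from this have "f ` V \<times> g ` W \<subseteq> map_prod f g ` U"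
      by force
    ultimately show "\<exists>V' W'. openin X' V' \<and> openin Y' W' \<and> x' \<in> V' \<and> y' \<in> W' \<and>
        V' \<times> W' \<subseteq> map_prod f g ` U"
      using assms xy unfolding open_map_def by (metis imageI)
  qed
qed

text \<open>A product of quotient maps need not be a quotient map. Openness of \<open>q\<close>
  makes \<open>map_prod q q\<close> open as well, so it is one, and closedness of the diagonal of
  \<open>Y\<close> can be tested on its preimage, the kernel relation of \<open>q\<close>.\<close>

lemma Hausdorff_space_open_quotient_iff:
  assumes "quotient_map X Y q" and "open_map X Y q"
  shows "Hausdorff_space Y \<longleftrightarrow>
    closedin (prod_topology X X) {(x, y) \<in> topspace X \<times> topspace X. q x = q y}"
proof -
  let ?D = "(\<lambda>y. (y, y)) ` topspace Y"
  have cont: "continuous_map X Y q" and surj: "q ` topspace X = topspace Y"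
    using assms(1) by (auto simp: quotient_imp_continuous_map quotient_imp_surjective_map)
  have "continuous_map (prod_topology X X) (prod_topology Y Y) (map_prod q q)"
    using cont unfolding map_prod_def case_prod_unfold
    by (intro continuous_map_pairedI continuous_map_compose[OF continuous_map_fst, unfolded o_def]
        continuous_map_compose[OF continuous_map_snd, unfolded o_def])
  moreover have "map_prod q q ` topspace (prod_topology X X) = topspace (prod_topology Y Y)"
    by (simp add: map_prod_surj_on[OF surj surj])
  ultimately have "quotient_map (prod_topology X X) (prod_topology Y Y) (map_prod q q)"
    using open_map_map_prod[OF assms(2) assms(2)] by (intro continuous_open_imp_quotient_map)
  moreover have "?D \<subseteq> topspace (prod_topology Y Y)"
    by auto
  ultimately have "closedin (prod_topology Y Y) ?D \<longleftrightarrow>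
      closedin (prod_topology X X) {p \<in> topspace (prod_topology X X). map_prod q q p \<in> ?D}"
    unfolding quotient_map_closedin by blast
  also have "{p \<in> topspace (prod_topology X X). map_prod q q p \<in> ?D} =
      {(x, y) \<in> topspace X \<times> topspace X. q x = q y}"
    using surj by (auto simp: image_iff)
  finally show ?thesis
    by (simp add: Hausdorff_space_closedin_diagonal)
qed

text \<open>The projection is open iff the saturation of every open \<open>U\<close> is open;
  \<open>nhd\<close> makes each point of the saturation an interior point.\<close>

lemma open_map_quotient_space:
  assumes r: "equiv (topspace T) r"
    and nhd: "\<And>U x y. \<lbrakk>openin T U; x \<in> U; (x, y) \<in> r\<rbrakk> \<Longrightarrow> \<exists>V. openin T V \<and> y \<in> V \<and> V \<subseteq> r `` U"
  shows "open_map T (quotient_space T r) (\<lambda>x. r `` {x})"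
  unfolding open_map_def openin_quotient_space
proof (intro allI impI conjI)
  fix U assume U: "openin T U"
  then show "(\<lambda>x. r `` {x}) ` U \<subseteq> topspace T // r"
    using openin_subset by (fastforce intro: quotientI)
  have "{x \<in> topspace T. r `` {x} \<in> (\<lambda>x. r `` {x}) ` U} = r `` U"
    using openin_subset[OF U] equiv_class_eq_iff[OF r] by (auto simp: image_iff) blast
  moreover have "openin T (r `` U)"
    using nhd[OF U] by (subst openin_subopen) blast
  ultimately show "openin T {x \<in> topspace T. r `` {x} \<in> (\<lambda>x. r `` {x}) ` U}"
    by simp
qed

lemma (in semitopological_monoid) open_map_quotient_space_congruence:
  assumes shifts: "open_left_shifts S T \<or> open_right_shifts S T"
    and cong: "monoid_congruence S r"
  shows "open_map T (quotient_space T r) (\<lambda>x. r `` {x})"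
proof (rule open_map_quotient_space)
  show r: "equiv (topspace T) r"
    using cong by (simp add: monoid_congruence_def topspace_carrier)
  have mult: "(a \<otimes> c, b \<otimes> d) \<in> r" if "(a, b) \<in> r" "(c, d) \<in> r" for a b c d
    using cong that by (simp add: monoid_congruence_def)
  have refl: "(w, w) \<in> r" if "w \<in> carrier S" for w
    using r that by (simp add: equiv_def refl_on_def topspace_carrier)
  fix U x y assume U: "openin T U" and x: "x \<in> U" and xy: "(x, y) \<in> r"
  have carr: "x \<in> carrier S" "y \<in> carrier S"
    using r xy by (auto simp: topspace_carrier[symmetric] equiv_class_eq_iff)
  from shifts show "\<exists>V. openin T V \<and> y \<in> V \<and> V \<subseteq> r `` U"
  proof
    assume op: "open_left_shifts S T"
    let ?W = "{w \<in> topspace T. x \<otimes> w \<in> U}"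
    have "openin T ?W"
      using left_shift_continuous[OF carr(1)] U by (rule openin_continuous_map_preimage)
    with op carr have "openin T ((\<lambda>w. y \<otimes> w) ` ?W)"
      by (simp add: open_left_shifts_def open_map_def)
    \<comment> \<open>The witness is the identity: it lies in \<open>?W\<close> since its left shift
      by \<open>x\<close> is \<open>x\<close> itself, a point of \<open>U\<close>.\<close>
    moreover have "y \<in> (\<lambda>w. y \<otimes> w) ` ?W"
      using carr x by (intro image_eqI[where x = \<one>]) (auto simp: topspace_carrier)
    \<comment> \<open>For \<open>w\<close> in \<open>?W\<close>, multiplying x \<sim> y by w \<sim>
      w relates the point \<open>x \<otimes> w\<close> of \<open>U\<close> to
      \<open>y \<otimes> w\<close>.\<close>
    moreover have "(\<lambda>w. y \<otimes> w) ` ?W \<subseteq> r `` U"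
      using mult[OF xy refl] by (auto simp: topspace_carrier)
    ultimately show ?thesis by blast
  next
    assume op: "open_right_shifts S T"
    \<comment> \<open>Mirror image of the first case, with the factor \<open>w\<close> on the
      left.\<close>
    let ?W = "{w \<in> topspace T. w \<otimes> x \<in> U}"
    have "openin T ?W"
      using right_shift_continuous[OF carr(1)] U by (rule openin_continuous_map_preimage)
    with op carr have "openin T ((\<lambda>w. w \<otimes> y) ` ?W)"
      by (simp add: open_right_shifts_def open_map_def)
    moreover have "y \<in> (\<lambda>w. w \<otimes> y) ` ?W"
      using carr x by (intro image_eqI[where x = \<one>]) (auto simp: topspace_carrier)
    moreover have "(\<lambda>w. w \<otimes> y) ` ?W \<subseteq> r `` U"
      using mult[OF refl xy] by (auto simp: topspace_carrier)
    ultimately show ?thesis by blast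
  qed
qed

theorem corollary2p4:
  fixes S :: "('a, 'b) monoid_scheme" and T :: "'a topology" and r :: "('a \<times> 'a) set"
  assumes "semitopological_monoid S T"
    and "open_left_shifts S T \<or> open_right_shifts S T"
    and "monoid_congruence S r"
  shows "Hausdorff_space (quotient_space T r) \<longleftrightarrow> closedin (prod_topology T T) r"
proof -
  interpret semitopological_monoid S T by fact
  have r: "equiv (topspace T) r"
    using assms(3) by (simp add: monoid_congruence_def topspace_carrier)
  \<comment> \<open>The kernel relation of the projection is the congruence itself.\<close>
  have "{(x, y) \<in> topspace T \<times> topspace T. r `` {x} = r `` {y}} = r"
    using equiv_class_eq_iff[OF r] by auto
  then show ?thesis
    using Hausdorff_space_open_quotient_iff[OF quotient_map_quotient_space
        open_map_quotient_space_congruence[OF assms(2,3)]] by simp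
qed

end
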